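(* Let $p$ be a prime. Any regular equation $u(x)=1$ in one unknown over the Heisenberg $p$-group $\mathrm{UT}_3(\mathbb{F}_p)$ with exponent $rp^s$, where $r \in \mathbb{Z}$, $s \in \mathbb{N}$ (with $s=0$ allowed) and $\gcd(r,p)=1$, is solvable in an overgroup of $\mathrm{UT}_3(\mathbb{F}_p)$ isomorphic to $\mathrm{UT}_{2p^s+1}(\mathbb{F}_p)$.
   Context: $\mathbb{F}_p$ is the field with $p$ elements, and $\mathrm{UT}_n(\mathbb{F}_p)$ is the group of $n\times n$ upper unitriangular matrices over $\mathbb{F}_p$. An equation with the variable $x$ over a group $G$ is an expression $u(x)=1$, where $u(x) = x^{\epsilon_1} g_1 x^{\epsilon_2} g_2 \cdots x^{\epsilon_k} g_k$ is an element of the free product $G * \langle x\rangle$ of $G$ with the infinite cyclic group $\langle x \rangle$ ($g_i \in G$, $\epsilon_i \in \mathbb{Z}$). Its exponent is $\epsilon = \sum_{i=1}^k \epsilon_i$, and the equation is called regular if $\epsilon \neq 0$. An overgroup of $G$ is a group $H$ containing $G$ as a fixed subgroup (equivalently, a group $H$ with a fixed injective homomorphism $\phi: G \to H$). The equation is solvable in the overgroup $H$ if there is $h \in H$ with $u(h)=1$, i.e. $h^{\epsilon_1}\phi(g_1) h^{\epsilon_2}\phi(g_2)\cdots h^{\epsilon_k}\phi(g_k)=1$ in $H$. *)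

theory Defs
  imports
    "HOL-Algebra.Group"
    "HOL-Library.Cardinality"
    "HOL-Computational_Algebra.Primes"
    "Jordan_Normal_Form.Matrix"
begin

definition UT :: "nat \<Rightarrow> 'a::field mat monoid" where
  "UT n = \<lparr>carrier = {A \<in> carrier_mat n n. upper_triangular A \<and> (\<forall>i<n. A $$ (i, i) = 1)},
           mult = (*), one = 1\<^sub>m n\<rparr>"

text \<open>The word \<open>x\<^bsup>e1\<^esup> g1 \<dots> x\<^bsup>ek\<^esup> gk\<close>, standing for the element of the free product
  of the coefficient group with the infinite cyclic group on \<open>x\<close> that it represents,
  is the list \<open>[(e1, g1), \<dots>, (ek, gk)]\<close>. Exponents may be 0 and coefficients may be trivial,
  so every element of the free product is represented; the exponent of a word and its value
  at an element of an overgroup depend only on the element represented.\<close>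

type_synonym 'g eqn = "(int \<times> 'g) list"

definition eqn_over :: "('g, 'm) monoid_scheme \<Rightarrow> 'g eqn \<Rightarrow> bool" where
  "eqn_over G u \<longleftrightarrow> snd ` set u \<subseteq> carrier G"

definition eqn_exponent :: "'g eqn \<Rightarrow> int" where
  "eqn_exponent u = sum_list (map fst u)"

definition regular_eqn :: "'g eqn \<Rightarrow> bool" where
  "regular_eqn u \<longleftrightarrow> eqn_exponent u \<noteq> 0"

definition overgroup ::
  "('g, 'm) monoid_scheme \<Rightarrow> ('h, 'n) monoid_scheme \<Rightarrow> ('g \<Rightarrow> 'h) \<Rightarrow> bool" where
  "overgroup G H \<phi> \<longleftrightarrow> group H \<and> \<phi> \<in> mon G H"

primrec eqn_value :: "('h, 'n) monoid_scheme \<Rightarrow> ('g \<Rightarrow> 'h) \<Rightarrow> 'g eqn \<Rightarrow> 'h \<Rightarrow> 'h" where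
  "eqn_value H \<phi> [] h = \<one>\<^bsub>H\<^esub>"
| "eqn_value H \<phi> (t # u) h =
     (h [^]\<^bsub>H\<^esub> fst t \<otimes>\<^bsub>H\<^esub> \<phi> (snd t)) \<otimes>\<^bsub>H\<^esub> eqn_value H \<phi> u h"

definition solvable_in :: "('h, 'n) monoid_scheme \<Rightarrow> ('g \<Rightarrow> 'h) \<Rightarrow> 'g eqn \<Rightarrow> bool" where
  "solvable_in H \<phi> u \<longleftrightarrow> (\<exists>h \<in> carrier H. eqn_value H \<phi> u h = \<one>\<^bsub>H\<^esub>)"

end

theory Submission
  imports Defs
    "HOL-Computational_Algebra.Formal_Laurent_Series"
    "HOL-Number_Theory.Residues"
    "Jordan_Normal_Form.Determinant"
begin

text \<open>Let \<open>q = p^s\<close> and let \<open>\<alpha>\<close>, \<open>\<beta>\<close> be the sums of the \<open>(0, 1)\<close> and \<open>(1, 2)\<close> entries of the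
  coefficients of the equation. The overgroup is \<open>UT\<^sub>2\<^sub>q\<^sub>+\<^sub>1\<close> itself, and the embedding depends
  on the equation.

  If \<open>\<alpha> \<noteq> 0\<close>, let \<open>UT\<^sub>2\<^sub>q\<^sub>+\<^sub>1\<close> act on \<open>R = F[[t]]/(t^(2q))\<close> by affine maps, embed
  \<open>(a, b, c)\<close> as \<open>f \<mapsto> (1 + a t^q) f + t^(q-1) (b + c t^q)\<close> and look for a solution of the form
  \<open>f \<mapsto> X f + v\<close> with \<open>X = 1 + k t\<close>. As \<open>X^q = 1 + k^q t^q\<close>, the linear part of the value
  of the equation is \<open>1\<close> for suitable \<open>k \<noteq> 0\<close>. The translation part is \<open>S v + t^(q-1) F\<close>, and
  telescoping gives \<open>(X - 1) S + t^q U = 0\<close> with \<open>U(0) = \<alpha>\<close>; so \<open>S\<close> is \<open>t^(q-1)\<close> times a unit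
  and \<open>v\<close> can be solved for. The case \<open>\<beta> \<noteq> 0\<close> follows by an automorphism of \<open>UT\<^sub>3\<close>.

  If \<open>\<alpha> = \<beta> = 0\<close>, the product of the coefficients is central, and in a suitable embedding every
  central element has a \<open>q\<close>-th root that commutes with the image of \<open>UT\<^sub>3\<close>.\<close>

no_notation vec_index (infixl \<open>$\<close> 100)
notation fps_nth (infixl \<open>$\<close> 75)

section \<open>Unitriangular matrices as a group\<close>

lemma carrier_UT_iff:
  "A \<in> carrier (UT n) \<longleftrightarrow>
     A \<in> carrier_mat n n \<and> (\<forall>i<n. \<forall>j<i. A $$ (i, j) = 0) \<and> (\<forall>i<n. A $$ (i, i) = 1)"
  by (auto simp: UT_def)

lemma mult_UT [simp]: "mult (UT n) = (*)"
  and one_UT [simp]: "one (UT n) = 1\<^sub>m n"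
  by (simp_all add: UT_def)

lemma carrier_UT_dim:
  assumes "A \<in> carrier (UT n)"
  shows "A \<in> carrier_mat n n" "dim_row A = n" "dim_col A = n"
  using assms by (auto simp: carrier_UT_iff)

text \<open>\<open>A $$ (i, l)\<close> vanishes for \<open>l < i\<close> and
  \<open>B $$ (l, j)\<close> for \<open>l > j\<close>. For \<open>j < i\<close> the range is empty,
  which gives triangularity of the product.\<close>

lemma UT_mult_index:
  assumes A: "A \<in> carrier (UT n)" and B: "B \<in> carrier (UT n)" and "i < n" "j < n"
  shows "(A * B) $$ (i, j) = (\<Sum>l\<in>{i..j}. A $$ (i, l) * B $$ (l, j))"
proof -
  have "(A * B) $$ (i, j) = (\<Sum>l\<in>{0..<n}. A $$ (i, l) * B $$ (l, j))"
    using carrier_UT_dim[OF A] carrier_UT_dim[OF B] assms(3,4) by (simp add: scalar_prod_def)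
  also have "\<dots> = (\<Sum>l\<in>{i..j}. A $$ (i, l) * B $$ (l, j))"
  proof (rule sum.mono_neutral_right)
    show "\<forall>l\<in>{0..<n} - {i..j}. A $$ (i, l) * B $$ (l, j) = 0"
    proof
      fix l assume "l \<in> {0..<n} - {i..j}"
      then have "l < n" "l < i \<or> j < l" by auto
      then show "A $$ (i, l) * B $$ (l, j) = 0"
        using A B assms(3,4) by (auto simp: carrier_UT_iff)
    qed
  qed (use assms(4) in auto)
  finally show ?thesis .
qed

lemma UT_mult_closed:
  assumes A: "A \<in> carrier (UT n)" and B: "B \<in> carrier (UT n)"
  shows "A * B \<in> carrier (UT n)"
proof -
  have "(A * B) $$ (i, j) = 0" if "i < n" "j < i" for i j
    using UT_mult_index[OF A B] that by simp
  moreover have "(A * B) $$ (i, i) = 1" if "i < n" for i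
    using UT_mult_index[OF A B that that] A B that by (simp add: carrier_UT_iff)
  ultimately show ?thesis
    using carrier_UT_dim[OF A] carrier_UT_dim[OF B] by (auto simp: carrier_UT_iff)
qed

lemma one_UT_carrier: "1\<^sub>m n \<in> carrier (UT n)"
  by (auto simp: carrier_UT_iff)

lemma finite_carrier_mat: "finite (carrier_mat m n :: 'a::finite mat set)"
proof -
  let ?I = "{0..<m} \<times> {0..<n}"
  have "carrier_mat m n \<subseteq> mat m n ` (?I \<rightarrow>\<^sub>E (UNIV :: 'a set))"
  proof
    fix A :: "'a mat" assume A: "A \<in> carrier_mat m n"
    have "A = mat m n (restrict (\<lambda>ij. A $$ ij) ?I)"
      using A by (intro eq_matI) auto
    moreover have "restrict (\<lambda>ij. A $$ ij) ?I \<in> ?I \<rightarrow>\<^sub>E UNIV"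
      by simp
    ultimately show "A \<in> mat m n ` (?I \<rightarrow>\<^sub>E UNIV)"
      by (rule image_eqI)
  qed
  moreover have "finite (?I \<rightarrow>\<^sub>E (UNIV :: 'a set))"
    by (rule finite_PiE) simp_all
  ultimately show ?thesis
    by (rule finite_subset[OF _ finite_imageI])
qed

text \<open>The inverse is found without checking that it is unitriangular: since
  \<open>det A\<close> is 1, right multiplication by \<open>A\<close> is injective, hence surjective
  on the finite carrier, and so reaches the identity.\<close>

lemma group_UT: "group (UT n :: 'a::{field,finite} mat monoid)"
proof (rule groupI)
  fix A :: "'a mat" assume A: "A \<in> carrier (UT n)"
  let ?C = "carrier (UT n) :: 'a mat set"
  have Am: "A \<in> carrier_mat n n" using A by (rule carrier_UT_dim)
  have "upper_triangular A" using A by (simp add: UT_def)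
  then have "det A = prod_list (diag_mat A)" using Am by (rule det_upper_triangular)
  also have "diag_mat A = replicate n 1"
    using A Am by (auto simp: diag_mat_def carrier_UT_iff list_eq_iff_nth_eq)
  finally have "det A \<noteq> 0" by simp
  from det_non_zero_imp_unit[OF Am this]
  obtain A' where A': "A' \<in> carrier_mat n n" "A * A' = 1\<^sub>m n"
    by (auto simp: Units_def ring_mat_def)
  have "inj_on (\<lambda>B. B * A) ?C"
  proof (rule inj_onI)
    fix B C assume B: "B \<in> ?C" and C: "C \<in> ?C" and eq: "B * A = C * A"
    have "B * (A * A') = B * A * A'" "C * (A * A') = C * A * A'"
      using assoc_mult_mat[OF carrier_UT_dim(1)[OF B] Am A'(1)]
        assoc_mult_mat[OF carrier_UT_dim(1)[OF C] Am A'(1)] by simp_all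
    then have "B * (A * A') = C * (A * A')"
      using eq by simp
    then show "B = C" using A'(2) carrier_UT_dim(1)[OF B] carrier_UT_dim(1)[OF C] by simp
  qed
  moreover have "finite ?C"
    by (rule finite_subset[OF _ finite_carrier_mat[of n n]]) (auto simp: carrier_UT_iff)
  moreover have "(\<lambda>B. B * A) ` ?C \<subseteq> ?C"
    using A UT_mult_closed by blast
  ultimately have "(\<lambda>B. B * A) ` ?C = ?C"
    by (simp add: endo_inj_surj)
  moreover have "1\<^sub>m n \<in> ?C" by (rule one_UT_carrier)
  ultimately have "1\<^sub>m n \<in> (\<lambda>B. B * A) ` ?C"
    by (simp only:)
  then obtain B where "B \<in> ?C" "1\<^sub>m n = B * A" ..
  then show "\<exists>B\<in>?C. B \<otimes>\<^bsub>UT n\<^esub> A = \<one>\<^bsub>UT n\<^esub>"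
    unfolding mult_UT one_UT by (intro bexI[of _ B]) simp_all
next
  fix A B C :: "'a mat"
  assume "A \<in> carrier (UT n)" "B \<in> carrier (UT n)" "C \<in> carrier (UT n)"
  then show "A \<otimes>\<^bsub>UT n\<^esub> B \<otimes>\<^bsub>UT n\<^esub> C = A \<otimes>\<^bsub>UT n\<^esub> (B \<otimes>\<^bsub>UT n\<^esub> C)"
    unfolding mult_UT
    by (rule assoc_mult_mat[OF carrier_UT_dim(1) carrier_UT_dim(1) carrier_UT_dim(1)])
qed (simp_all add: UT_mult_closed one_UT_carrier left_mult_one_mat[OF carrier_UT_dim(1)])

section \<open>Integer powers of power series\<close>

text \<open>Laurent series form a field, where the laws for integer powers hold; this embedding
  carries them back to power series with nonzero constant term.\<close>

lemma fps_to_fls_powi: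
  fixes X :: "'a::field fps"
  assumes "X $ 0 \<noteq> 0"
  shows "fps_to_fls (X powi n) = fps_to_fls X powi n"
  using assms by (auto simp: power_int_def fps_to_fls_power fls_inverse_fps_to_fls)

lemma fps_powi_add:
  fixes X :: "'a::field fps"
  assumes "X $ 0 \<noteq> 0"
  shows "X powi (m + n) = X powi m * X powi n"
proof -
  have "X \<noteq> 0" using assms by auto
  then have "fps_to_fls (X powi (m + n)) = fps_to_fls (X powi m * X powi n)"
    by (simp add: fps_to_fls_powi assms fls_times_fps_to_fls power_int_add)
  then show ?thesis by simp
qed

lemma fps_powi_mult:
  fixes X :: "'a::field fps"
  assumes "X $ 0 \<noteq> 0"
  shows "X powi (int m * n) = (X ^ m) powi n"
proof -
  have "(X ^ m) $ 0 \<noteq> 0" using assms by (simp add: fps_nth_power_0)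
  then have "fps_to_fls (X powi (int m * n)) = fps_to_fls ((X ^ m) powi n)"
    by (simp add: fps_to_fls_powi assms fps_to_fls_power power_int_power)
  then show ?thesis by simp
qed

lemma fps_powi_nth_0:
  fixes X :: "'a::field fps"
  assumes "X $ 0 = 1"
  shows "(X powi n) $ 0 = 1"
  using assms by (simp add: power_int_def fps_nth_power_0)

text \<open>Used with \<open>Y = t^q\<close>, whose square vanishes modulo \<open>t^(2q)\<close>.
  Natural exponents go by induction, and a negative power is the inverse of such an
  expansion.\<close>

lemma one_plus_powi:
  fixes Y :: "'a::field fps"
  assumes "Y $ 0 = 0"
  shows "\<exists>R. (1 + fps_const k * Y) powi n = 1 + fps_const (of_int n * k) * Y + Y ^ 2 * R"
proof -
  let ?Z = "1 + fps_const k * Y"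
  have pos: "\<exists>R. ?Z ^ m = 1 + fps_const (of_nat m * k) * Y + Y ^ 2 * R" for m
  proof (induction m)
    case 0
    have "?Z ^ 0 = 1 + fps_const (of_nat 0 * k) * Y + Y ^ 2 * 0" by simp
    then show ?case by blast
  next
    case (Suc m)
    then obtain R where R: "?Z ^ m = 1 + fps_const (of_nat m * k) * Y + Y ^ 2 * R" by blast
    have c: "fps_const (of_nat (Suc m) * k) = fps_const k + fps_const (of_nat m * k)"
      by (simp add: algebra_simps)
    have "?Z ^ Suc m = 1 + fps_const (of_nat (Suc m) * k) * Y
        + Y ^ 2 * (R + fps_const k * fps_const (of_nat m * k) + fps_const k * Y * R)"
      unfolding c power_Suc R power2_eq_square by (simp only: ring_distribs mult_1_left mult_1_right ac_simps)
    then show ?case by blast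
  qed
  show ?thesis
  proof (cases "n \<ge> 0")
    case True
    then show ?thesis using pos[of "nat n"] by (simp add: power_int_def)
  next
    case False
    define m where "m = nat (- n)"
    have n: "n = - int m" using False by (simp add: m_def)
    obtain R where R: "?Z ^ m = 1 + fps_const (of_nat m * k) * Y + Y ^ 2 * R"
      using pos by blast
    define I where "I = inverse (?Z ^ m)"
    have I: "?Z powi n = I"
      using False assms by (simp add: power_int_def I_def fps_inverse_power m_def)
    define K where "K = fps_const (of_nat m * k)"
    have c: "fps_const (of_int n * k) = - K" by (simp add: n K_def)
    have "I * (1 + K * Y + Y ^ 2 * R) = 1"
      unfolding I_def K_def R[symmetric] using assms
      by (intro inverse_mult_eq_1) (simp add: fps_nth_power_0)
    then have I1: "I = 1 - K * Y * I - Y ^ 2 * R * I"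
      by (simp add: algebra_simps)
    \<comment> \<open>The equation for \<open>I\<close> is substituted once into its own linear
      term, so that what remains beyond \<open>1 - K * Y\<close> is divisible by
      \<open>Y ^ 2\<close>.\<close>
    have "I = 1 - K * Y * (1 - K * Y * I - Y ^ 2 * R * I) - Y ^ 2 * R * I"
      using arg_cong[OF I1, of "\<lambda>z. 1 - K * Y * z - Y ^ 2 * R * I"] I1 by (rule trans[rotated])
    also have "\<dots> = 1 + (- K) * Y + Y ^ 2 * (K * K * I + K * Y * R * I - R * I)"
      by (simp add: algebra_simps power2_eq_square)
    finally have "I = 1 + (- K) * Y + Y ^ 2 * (K * K * I + K * Y * R * I - R * I)" .
    then show ?thesis unfolding I c by blast
  qed
qed

section \<open>Affine maps of truncated power series\<close>

text \<open>The Cauchy product in the form in which it appears when two Toeplitz matrices are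
  multiplied.\<close>

lemma sum_fps_nth_shift:
  fixes X Y :: "'a::comm_ring_1 fps"
  assumes "i \<le> j"
  shows "(\<Sum>l\<in>{i..j}. X $ (l - i) * Y $ (j - l)) = (X * Y) $ (j - i)"
proof -
  have "(\<Sum>l\<in>{i..j}. X $ (l - i) * Y $ (j - l)) = (\<Sum>l\<in>{0..j - i}. X $ l * Y $ (j - i - l))"
    by (rule sum.reindex_bij_witness[of _ "\<lambda>l. l + i" "\<lambda>l. l - i"]) (use assms in auto)
  then show ?thesis by (simp add: fps_mult_nth)
qed

text \<open>The affine map \<open>f \<mapsto> X f + v\<close> of \<open>F[[t]]/(t^m)\<close>, in the basis
  \<open>t^(m-1), \<dots>, t, 1\<close>.\<close>

definition affine_mat :: "nat \<Rightarrow> 'a::field fps \<Rightarrow> 'a fps \<Rightarrow> 'a mat" where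
  "affine_mat m X v = mat (Suc m) (Suc m) (\<lambda>(i, j).
     if j < i then 0 else if j < m then X $ (j - i) else if i < m then v $ (m - 1 - i) else 1)"

lemma affine_mat_carrier:
  assumes "X $ 0 = 1"
  shows "affine_mat m X v \<in> carrier (UT (Suc m))"
  using assms by (auto simp: carrier_UT_iff affine_mat_def)

lemma affine_mat_mult:
  assumes "X $ 0 = 1" "Y $ 0 = 1"
  shows "affine_mat m X v * affine_mat m Y w = affine_mat m (X * Y) (v + X * w)"
    (is "?A * ?B = ?C")
proof (rule eq_matI)
  have A: "?A \<in> carrier (UT (Suc m))" and B: "?B \<in> carrier (UT (Suc m))"
    using assms by (auto intro: affine_mat_carrier)
  fix i j assume "i < dim_row ?C" "j < dim_col ?C"
  then have ij: "i < Suc m" "j < Suc m" by (simp_all add: affine_mat_def)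
  have "(?A * ?B) $$ (i, j) = (\<Sum>l\<in>{i..j}. ?A $$ (i, l) * ?B $$ (l, j))"
    by (rule UT_mult_index[OF A B ij])
  also have "\<dots> = ?C $$ (i, j)"
  proof -
    consider "j < i" | "i \<le> j" "j < m" | "i < m" "j = m" | "i = m" "j = m"
      using ij by linarith
    then show ?thesis
    proof cases
      case 2
      then have "(\<Sum>l\<in>{i..j}. ?A $$ (i, l) * ?B $$ (l, j)) = (\<Sum>l\<in>{i..j}. X $ (l - i) * Y $ (j - l))"
        using ij by (intro sum.cong) (auto simp: affine_mat_def)
      then show ?thesis using 2 by (simp add: sum_fps_nth_shift affine_mat_def)
    next
      case 3
      \<comment> \<open>Column \<open>m\<close> is the translation column: the summand
        \<open>l = m\<close> contributes \<open>v\<close>, the others form the convolution of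
        \<open>X\<close> with \<open>w\<close>.\<close>
      then have "{i..j} = insert m {i..m - 1}" by auto
      then have "(\<Sum>l\<in>{i..j}. ?A $$ (i, l) * ?B $$ (l, j)) =
          ?A $$ (i, m) * ?B $$ (m, m) + (\<Sum>l\<in>{i..m - 1}. ?A $$ (i, l) * ?B $$ (l, m))"
        using 3 by (subst sum.insert[symmetric]) auto
      also have "(\<Sum>l\<in>{i..m - 1}. ?A $$ (i, l) * ?B $$ (l, m)) =
          (\<Sum>l\<in>{i..m - 1}. X $ (l - i) * w $ (m - 1 - l))"
        using 3 by (intro sum.cong) (auto simp: affine_mat_def)
      also have "\<dots> = (X * w) $ (m - 1 - i)"
        using 3 by (intro sum_fps_nth_shift) auto
      finally show ?thesis using 3 by (simp add: affine_mat_def)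
    qed (use ij in \<open>auto simp: affine_mat_def\<close>)
  qed
  finally show "(?A * ?B) $$ (i, j) = ?C $$ (i, j)" .
qed (auto simp: affine_mat_def)

text \<open>Row 0 lists the coefficients of the linear part, and the last column those of the
  translation part in reverse order; so the matrix determines both series exactly modulo
  \<open>t^m\<close>.\<close>

lemma affine_mat_eq_iff:
  fixes X Y v w :: "'a::field fps"
  assumes "m > 0"
  shows "affine_mat m X v = affine_mat m Y w \<longleftrightarrow> (\<forall>n<m. X $ n = Y $ n \<and> v $ n = w $ n)"
proof
  assume eq: "affine_mat m X v = affine_mat m Y w"
  show "\<forall>n<m. X $ n = Y $ n \<and> v $ n = w $ n"
  proof (intro allI impI conjI)
    fix n assume n: "n < m"
    have "affine_mat m Z u $$ (0, n) = Z $ n" for Z u :: "'a fps"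
      using n by (simp add: affine_mat_def)
    with eq show "X $ n = Y $ n" by metis
    have "m - 1 - (m - 1 - n) = n" "m - 1 - n < m" using n by auto
    then have "affine_mat m Z u $$ (m - 1 - n, m) = u $ n" for Z u :: "'a fps"
      by (simp add: affine_mat_def del: diff_Suc_1 One_nat_def)
    with eq show "v $ n = w $ n" by metis
  qed
next
  assume eq: "\<forall>n<m. X $ n = Y $ n \<and> v $ n = w $ n"
  have "X $ (j - i) = Y $ (j - i)" if "j < m" for i j
    using eq that by auto
  moreover have "v $ (m - 1 - i) = w $ (m - 1 - i)" for i
    using eq assms by auto
  ultimately show "affine_mat m X v = affine_mat m Y w"
    unfolding affine_mat_def by (intro cong_mat) simp_all
qed

lemma affine_mat_mod_X_power:
  fixes X v R S :: "'a::field fps"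
  assumes "m > 0"
  shows "affine_mat m (X + fps_X ^ m * R) (v + fps_X ^ m * S) = affine_mat m X v"
proof -
  have "(f + fps_X ^ m * g) $ n = f $ n" if "n < m" for f g :: "'a fps" and n
    using that by (simp add: fps_X_power_mult_nth)
  then show ?thesis
    unfolding affine_mat_eq_iff[OF assms] by blast
qed

lemma affine_mat_1_0: "affine_mat m 1 0 = 1\<^sub>m (Suc m)"
  by (intro eq_matI) (auto simp: affine_mat_def)

text \<open>\<open>Z\<close> plays the role of the quotient \<open>(X^e - 1) / (X - 1)\<close>,
  described by a product because \<open>X - 1\<close> is not a unit. It is the same for all
  \<open>v\<close>, so the translation part of a power is linear in \<open>v\<close>.\<close>

lemma affine_mat_int_pow:
  fixes X :: "'a::{field,finite} fps" and e :: int
  assumes X: "X $ 0 = 1"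
  shows "\<exists>Z. (X - 1) * Z = X powi e - 1 \<and>
    (\<forall>v. affine_mat m X v [^]\<^bsub>UT (Suc m)\<^esub> e = affine_mat m (X powi e) (Z * v))"
proof -
  let ?G = "UT (Suc m) :: 'a mat monoid"
  interpret group ?G by (rule group_UT)
  have pos: "\<exists>Z. (X - 1) * Z = X ^ n - 1 \<and>
    (\<forall>v. affine_mat m X v [^]\<^bsub>?G\<^esub> n = affine_mat m (X ^ n) (Z * v))" for n
  proof (induction n)
    case 0
    show ?case by (intro exI[of _ 0]) (simp add: affine_mat_1_0)
  next
    case (Suc n)
    then obtain Z where Z: "(X - 1) * Z = X ^ n - 1"
      "\<And>v. affine_mat m X v [^]\<^bsub>?G\<^esub> n = affine_mat m (X ^ n) (Z * v)" by blast
    show ?case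
    proof (intro exI[of _ "Z + X ^ n"] conjI allI)
      show "(X - 1) * (Z + X ^ n) = X ^ Suc n - 1"
        unfolding distrib_left Z(1) by (simp add: left_diff_distrib)
      show "affine_mat m X v [^]\<^bsub>?G\<^esub> Suc n = affine_mat m (X ^ Suc n) ((Z + X ^ n) * v)" for v
      proof -
        have "affine_mat m X v [^]\<^bsub>?G\<^esub> Suc n = affine_mat m (X ^ n) (Z * v) * affine_mat m X v"
          by (simp add: Z(2))
        also have "\<dots> = affine_mat m (X ^ n * X) (Z * v + X ^ n * v)"
          using X by (intro affine_mat_mult) (simp_all add: fps_nth_power_0)
        finally show ?thesis by (simp only: power_Suc2 distrib_right)
      qed
    qed
  qed
  show ?thesis
  proof (cases e rule: int_cases2)
    case (nonneg n)
    show ?thesis unfolding nonneg int_pow_int power_int_of_nat by (rule pos)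
  next
    case (nonpos n)
    obtain Z where Z: "(X - 1) * Z = X ^ n - 1"
      "\<And>v. affine_mat m X v [^]\<^bsub>?G\<^esub> n = affine_mat m (X ^ n) (Z * v)"
      using pos by blast
    define I where "I = inverse (X ^ n)"
    have Xn: "(X ^ n) $ 0 = 1" using X by (simp add: fps_nth_power_0)
    have I: "I * X ^ n = 1" "I $ 0 = 1"
      using Xn by (auto simp: I_def inverse_mult_eq_1)
    have e: "X powi e = I"
      using X by (cases "n = 0") (simp_all add: nonpos power_int_def I_def fps_inverse_power)
    show ?thesis
    \<comment> \<open>The map \<open>f -> X^n f + Z v\<close> has the inverse
      \<open>f -> I f - I Z v\<close>.\<close>
    proof (intro exI[of _ "- I * Z"] conjI allI)
      have "(X - 1) * (- I * Z) = - I * ((X - 1) * Z)" by (rule mult.left_commute)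
      also have "\<dots> = X powi e - 1"
        unfolding Z(1) e right_diff_distrib using I(1) by simp
      finally show "(X - 1) * (- I * Z) = X powi e - 1" .
      fix v
      let ?x = "affine_mat m X v"
      have "affine_mat m I (- I * Z * v) \<otimes>\<^bsub>?G\<^esub> ?x [^]\<^bsub>?G\<^esub> n = \<one>\<^bsub>?G\<^esub>"
        unfolding Z(2) mult_UT one_UT affine_mat_mult[OF I(2) Xn] I(1)
        by (simp add: affine_mat_1_0 mult.assoc)
      then have inv: "inv\<^bsub>?G\<^esub> (?x [^]\<^bsub>?G\<^esub> n) = affine_mat m I (- I * Z * v)"
        by (rule inv_equality) (intro nat_pow_closed affine_mat_carrier X I(2))+
      show "?x [^]\<^bsub>?G\<^esub> e = affine_mat m (X powi e) (- I * Z * v)"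
        unfolding e inv[symmetric] unfolding nonpos
        by (rule int_pow_neg_int) (rule affine_mat_carrier[OF X])
    qed
  qed
qed

section \<open>Coordinates on the Heisenberg group\<close>

text \<open>Kept abstract so that one embedding argument serves both the matrix entries and the
  coordinates obtained from an automorphism.\<close>

definition heisenberg_coords ::
    "('a::field mat \<Rightarrow> 'a) \<Rightarrow> ('a mat \<Rightarrow> 'a) \<Rightarrow> ('a mat \<Rightarrow> 'a) \<Rightarrow> bool" where
  "heisenberg_coords a b c \<longleftrightarrow>
     inj_on (\<lambda>A. (a A, b A, c A)) (carrier (UT 3)) \<and>
     (\<forall>A\<in>carrier (UT 3). \<forall>B\<in>carrier (UT 3).
        a (A * B) = a A + a B \<and> b (A * B) = b A + b B \<and> c (A * B) = c A + c B + a A * b B)"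

lemma heisenberg_coordsI:
  assumes "\<And>A B. \<lbrakk>A \<in> carrier (UT 3); B \<in> carrier (UT 3); a A = a B; b A = b B; c A = c B\<rbrakk> \<Longrightarrow> A = B"
    and "\<And>A B. \<lbrakk>A \<in> carrier (UT 3); B \<in> carrier (UT 3)\<rbrakk> \<Longrightarrow> a (A * B) = a A + a B"
    and "\<And>A B. \<lbrakk>A \<in> carrier (UT 3); B \<in> carrier (UT 3)\<rbrakk> \<Longrightarrow> b (A * B) = b A + b B"
    and "\<And>A B. \<lbrakk>A \<in> carrier (UT 3); B \<in> carrier (UT 3)\<rbrakk> \<Longrightarrow> c (A * B) = c A + c B + a A * b B"
  shows "heisenberg_coords a b c"
  unfolding heisenberg_coords_def
proof (intro conjI ballI inj_onI)
  fix A B assume "A \<in> carrier (UT 3)" "B \<in> carrier (UT 3)" "(a A, b A, c A) = (a B, b B, c B)"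
  then show "A = B" by (elim Pair_inject) (rule assms(1))
qed (rule assms(2-4); assumption)+

lemma heisenberg_coordsD:
  assumes "heisenberg_coords a b c" and A: "A \<in> carrier (UT 3)" and B: "B \<in> carrier (UT 3)"
  shows "a (A * B) = a A + a B" "b (A * B) = b A + b B" "c (A * B) = c A + c B + a A * b B"
    and "\<lbrakk>a A = a B; b A = b B; c A = c B\<rbrakk> \<Longrightarrow> A = B"
proof -
  note inj = conjunct1[OF assms(1)[unfolded heisenberg_coords_def]]
    and mult = conjunct2[OF assms(1)[unfolded heisenberg_coords_def], THEN bspec, OF A, THEN bspec, OF B]
  show "a (A * B) = a A + a B" by (rule mult[THEN conjunct1])
  show "b (A * B) = b A + b B" by (rule mult[THEN conjunct2, THEN conjunct1])
  show "c (A * B) = c A + c B + a A * b B" by (rule mult[THEN conjunct2, THEN conjunct2])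
  show "A = B" if "a A = a B" "b A = b B" "c A = c B"
    using inj_onD[OF inj _ A B] that by simp
qed

lemma UT3_mult_index:
  assumes "A \<in> carrier (UT 3)" "B \<in> carrier (UT 3)"
  shows "(A * B) $$ (0, 1) = A $$ (0, 1) + B $$ (0, 1)"
    and "(A * B) $$ (1, 2) = A $$ (1, 2) + B $$ (1, 2)"
    and "(A * B) $$ (0, 2) = A $$ (0, 2) + B $$ (0, 2) + A $$ (0, 1) * B $$ (1, 2)"
proof -
  have s: "{0..1} = {0, 1::nat}" "{1..2} = {1, 2::nat}" "{0..2} = {0, 1, 2::nat}" by auto
  have d: "A $$ (i, i) = 1" "B $$ (i, i) = 1" if "i < 3" for i
    using assms that by (auto simp: carrier_UT_iff)
  show "(A * B) $$ (0, 1) = A $$ (0, 1) + B $$ (0, 1)"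
    by (subst UT_mult_index[OF assms]) (simp_all add: s d del: One_nat_def)
  show "(A * B) $$ (1, 2) = A $$ (1, 2) + B $$ (1, 2)"
    by (subst UT_mult_index[OF assms]) (simp_all add: s d del: One_nat_def)
  show "(A * B) $$ (0, 2) = A $$ (0, 2) + B $$ (0, 2) + A $$ (0, 1) * B $$ (1, 2)"
    by (subst UT_mult_index[OF assms]) (simp_all add: s d del: One_nat_def)
qed

lemma UT3_eqI:
  assumes A: "A \<in> carrier (UT 3)" and B: "B \<in> carrier (UT 3)"
    and eq: "A $$ (0, 1) = B $$ (0, 1)" "A $$ (1, 2) = B $$ (1, 2)" "A $$ (0, 2) = B $$ (0, 2)"
  shows "A = B"
proof (rule eq_matI)
  fix i j assume "i < dim_row B" "j < dim_col B"
  then have ij: "i < 3" "j < 3" using carrier_UT_dim[OF B] by simp_all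
  then consider "j < i" | "i = j" | "i = 0" "j = 1" | "i = 1" "j = 2" | "i = 0" "j = 2"
    by linarith
  then show "A $$ (i, j) = B $$ (i, j)"
  proof cases
    case 1
    then show ?thesis using A B ij by (simp add: carrier_UT_iff)
  next
    case 2
    then show ?thesis using A B ij by (simp add: carrier_UT_iff)
  qed (use eq in simp_all)
qed (use carrier_UT_dim[OF A] carrier_UT_dim[OF B] in simp_all)

lemma heisenberg_coords_entries:
  "heisenberg_coords (\<lambda>A. A $$ (0, 1)) (\<lambda>A. A $$ (1, 2)) (\<lambda>A. A $$ (0, 2))"
  by (intro heisenberg_coordsI UT3_eqI UT3_mult_index)

text \<open>The map \<open>(a, b, c)\<close> to \<open>(b, a, a b - c)\<close> is an automorphism of
  the Heisenberg group, because \<open>(a + a') (b + b') - a b' = a b + a' b' + b a'\<close>. It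
  exchanges the roles of the sums \<alpha> and \<beta>.\<close>

lemma heisenberg_coords_swap:
  assumes coords: "heisenberg_coords a b c"
  shows "heisenberg_coords b a (\<lambda>A :: 'a::field mat. a A * b A - c A)"
proof (rule heisenberg_coordsI)
  fix A B :: "'a mat"
  assume AB: "A \<in> carrier (UT 3)" "B \<in> carrier (UT 3)"
  note mult = heisenberg_coordsD(1-3)[OF coords AB]
  show "b (A * B) = b A + b B" "a (A * B) = a A + a B" by (rule mult)+
  show "a (A * B) * b (A * B) - c (A * B) = a A * b A - c A + (a B * b B - c B) + b A * a B"
    unfolding mult by (simp add: algebra_simps)
  assume eq: "b A = b B" "a A = a B" "a A * b A - c A = a B * b B - c B"
  have "c A = c B" using eq(3) unfolding eq(1,2) by simp
  then show "A = B" using eq(1,2) by (intro heisenberg_coordsD(4)[OF coords AB])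
qed

section \<open>The affine embedding: one of the sums is nonzero\<close>

definition affine_embedding ::
    "nat \<Rightarrow> ('a::field mat \<Rightarrow> 'a) \<Rightarrow> ('a mat \<Rightarrow> 'a) \<Rightarrow> ('a mat \<Rightarrow> 'a) \<Rightarrow> 'a mat \<Rightarrow> 'a mat" where
  "affine_embedding q a b c A = affine_mat (2 * q) (1 + fps_const (a A) * fps_X ^ q)
     (fps_X ^ (q - 1) * (fps_const (b A) + fps_const (c A) * fps_X ^ q))"

text \<open>Composing the affine maps of \<open>(a, b, c)\<close> and \<open>(a', b', c')\<close>
  yields the cross term \<open>a b' t^(2q-1)\<close>, which is the Heisenberg one; the others,
  \<open>a a' t^(2q)\<close> in the linear part and \<open>a c' t^(3q-1)\<close> in the translation,
  vanish modulo \<open>t^(2q)\<close>.\<close>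

lemma affine_embedding_mon:
  assumes coords: "heisenberg_coords a b c" and q: "q > 0"
  shows "affine_embedding q a b c \<in> mon (UT 3) (UT (2 * q + 1))"
proof -
  let ?f = "affine_embedding q a b c"
  have "?f A \<in> carrier (UT (2 * q + 1))" for A
    using q affine_mat_carrier[of "1 + fps_const (a A) * fps_X ^ q" "2 * q"]
    by (simp add: affine_embedding_def)
  moreover have "?f (A * B) = ?f A * ?f B" if "A \<in> carrier (UT 3)" "B \<in> carrier (UT 3)" for A B
  proof -
    note abc = heisenberg_coordsD(1-3)[OF coords that]
    let ?Y = "fps_X ^ q :: 'a fps" and ?W = "fps_X ^ (q - 1) :: 'a fps"
    let ?a = "\<lambda>A. fps_const (a A)" and ?b = "\<lambda>A. fps_const (b A)" and ?c = "\<lambda>A. fps_const (c A)"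
    have YY: "?Y * ?Y = fps_X ^ (2 * q)" by (simp add: power_add[symmetric] mult_2)
    have lin: "(1 + x * Y) * (1 + x' * Y) = 1 + (x + x') * Y + Y * Y * (x * x')" for x x' Y :: "'a fps"
      by (simp add: algebra_simps)
    have trans: "W * (y + z * Y) + (1 + x * Y) * (W * (y' + z' * Y)) =
        W * ((y + y') + (z + z' + x * y') * Y) + Y * Y * (W * x * z')" for x y z y' z' W Y :: "'a fps"
      by (simp add: algebra_simps)
    have "?f A * ?f B = affine_mat (2 * q) ((1 + ?a A * ?Y) * (1 + ?a B * ?Y))
        (?W * (?b A + ?c A * ?Y) + (1 + ?a A * ?Y) * (?W * (?b B + ?c B * ?Y)))"
      unfolding affine_embedding_def using q by (intro affine_mat_mult) simp_all
    also have "\<dots> = affine_mat (2 * q) (1 + (?a A + ?a B) * ?Y)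
        (?W * ((?b A + ?b B) + (?c A + ?c B + ?a A * ?b B) * ?Y))"
      unfolding lin trans YY using q by (intro affine_mat_mod_X_power) simp
    also have "\<dots> = ?f (A * B)"
      unfolding affine_embedding_def abc fps_const_add[symmetric] fps_const_mult[symmetric] ..
    finally show ?thesis ..
  qed
  moreover have "inj_on ?f (carrier (UT 3))"
  proof (rule inj_onI)
    fix A B assume A: "A \<in> carrier (UT 3)" and B: "B \<in> carrier (UT 3)" and "?f A = ?f B"
    then have "\<forall>n<2 * q.
      (1 + fps_const (a A) * fps_X ^ q) $ n = (1 + fps_const (a B) * fps_X ^ q) $ n \<and>
      (fps_X ^ (q - 1) * (fps_const (b A) + fps_const (c A) * fps_X ^ q)) $ n =
      (fps_X ^ (q - 1) * (fps_const (b B) + fps_const (c B) * fps_X ^ q)) $ n"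
      using q unfolding affine_embedding_def by (intro affine_mat_eq_iff[THEN iffD1]) simp_all
    then have eq: "(1 + fps_const (a A) * fps_X ^ q) $ n = (1 + fps_const (a B) * fps_X ^ q) $ n"
      "(fps_X ^ (q - 1) * (fps_const (b A) + fps_const (c A) * fps_X ^ q)) $ n =
       (fps_X ^ (q - 1) * (fps_const (b B) + fps_const (c B) * fps_X ^ q)) $ n"
      if "n < 2 * q" for n
      using that by blast+
    \<comment> \<open>The three coordinates sit at \<open>t^q\<close>, \<open>t^(q-1)\<close> and
      \<open>t^(2q-1)\<close>, all below the truncation degree \<open>2 * q\<close>.\<close>
    have "a A = a B" using eq(1)[of q] q by simp
    moreover have "b A = b B" using eq(2)[of "q - 1"] q by (simp add: fps_X_power_mult_nth)
    moreover have "c A = c B"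
    proof -
      have "\<not> 2 * q - 1 < q - 1" "2 * q - 1 - (q - 1) = q" using q by auto
      then show ?thesis using eq(2)[of "2 * q - 1"] q
        by (simp add: fps_X_power_mult_nth del: One_nat_def)
    qed
    ultimately show "A = B"
      by (rule heisenberg_coordsD(4)[OF coords A B])
  qed
  ultimately show ?thesis
    unfolding mon_def hom_def mult_UT by (intro CollectI conjI ballI funcsetI)
qed

text \<open>Induction on the word with \<open>X\<close> fixed. \<open>Q\<close> is the product of
  the linear parts of the coefficients; \<open>S\<close> and \<open>F\<close> are independent of
  \<open>v\<close>, so the translation part is affine in \<open>v\<close>. The telescoping identity
  holds exactly and not only modulo \<open>t^(2q)\<close>, so that a factor \<open>t\<close> can
  later be cancelled from it.\<close>

lemma affine_embedding_eqn_value: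
  fixes u :: "'a::{field,finite} mat eqn" and X :: "'a fps"
  assumes X: "X $ 0 = 1" and q: "q > 0"
  shows "\<exists>S F U Q.
     (\<forall>v. eqn_value (UT (2 * q + 1)) (affine_embedding q a b c) u (affine_mat (2 * q) X v) =
          affine_mat (2 * q) (X powi eqn_exponent u * Q) (S * v + fps_X ^ (q - 1) * F)) \<and>
     (X - 1) * S + fps_X ^ q * U = X powi eqn_exponent u * Q - 1 \<and>
     U $ 0 = (\<Sum>t\<leftarrow>u. a (snd t)) \<and>
     (\<exists>R. Q = 1 + fps_const (\<Sum>t\<leftarrow>u. a (snd t)) * fps_X ^ q + fps_X ^ (2 * q) * R)"
proof (induction u)
  case Nil
  have "1\<^sub>m (2 * q + 1) = (affine_mat (2 * q) 1 0 :: 'a mat)" by (simp add: affine_mat_1_0)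
  then show ?case
    by (intro exI[of _ 0] exI[of _ 1]) (auto simp: eqn_exponent_def intro: exI[of _ 0])
next
  case (Cons t u)
  let ?H = "UT (2 * q + 1) :: 'a mat monoid" and ?f = "affine_embedding q a b c"
  let ?Y = "fps_X ^ q :: 'a fps" and ?W = "fps_X ^ (q - 1) :: 'a fps"
  obtain e g where t: "t = (e, g)" by (cases t)
  define n where "n = eqn_exponent u"
  define \<alpha> where "\<alpha> = (\<Sum>t\<leftarrow>u. a (snd t))"
  obtain S F U Q R where
    val: "\<And>v. eqn_value ?H ?f u (affine_mat (2 * q) X v) = affine_mat (2 * q) (X powi n * Q) (S * v + ?W * F)"
    and S: "(X - 1) * S + ?Y * U = X powi n * Q - 1" and U: "U $ 0 = \<alpha>"
    and Q: "Q = 1 + fps_const \<alpha> * ?Y + ?Y * ?Y * R"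
    using Cons.IH unfolding n_def \<alpha>_def mult_2 power_add by blast
  obtain Z where Z: "(X - 1) * Z = X powi e - 1"
    "\<And>v. affine_mat (2 * q) X v [^]\<^bsub>?H\<^esub> e = affine_mat (2 * q) (X powi e) (Z * v)"
    using affine_mat_int_pow[OF X, where m = "2 * q" and e = e] unfolding Suc_eq_plus1 by blast
  define A where "A = fps_const (a g)"
  define B where "B = fps_const (b g) + fps_const (c g) * ?Y"
  define L where "L = 1 + A * ?Y"
  define P where "P = X powi e"
  have Y0: "?Y $ 0 = 0" using q by simp
  have P0: "P $ 0 = 1" unfolding P_def by (rule fps_powi_nth_0[OF X])
  have L0: "L $ 0 = 1" using Y0 by (simp add: L_def)
  have Q0: "(X powi n * Q) $ 0 = 1" using Y0 by (simp add: Q fps_powi_nth_0[OF X])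
  have exponent: "X powi eqn_exponent (t # u) = P * X powi n"
    unfolding P_def n_def t eqn_exponent_def using X by (simp add: fps_powi_add)
  have sum: "(\<Sum>t\<leftarrow>t # u. a (snd t)) = a g + \<alpha>" by (simp add: t \<alpha>_def)
  show ?case
    unfolding exponent sum
  proof (intro exI conjI allI)
    fix v
    have "eqn_value ?H ?f (t # u) (affine_mat (2 * q) X v) =
        affine_mat (2 * q) P (Z * v) * affine_mat (2 * q) L (?W * B) *
          affine_mat (2 * q) (X powi n * Q) (S * v + ?W * F)"
      by (simp only: t eqn_value.simps fst_conv snd_conv mult_UT Z(2) val P_def
          affine_embedding_def A_def B_def L_def)
    also have "\<dots> = affine_mat (2 * q) (P * L) (Z * v + P * (?W * B)) *
          affine_mat (2 * q) (X powi n * Q) (S * v + ?W * F)"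
      by (simp only: affine_mat_mult P0 L0)
    also have "\<dots> = affine_mat (2 * q) (P * L * (X powi n * Q))
        (Z * v + P * (?W * B) + P * L * (S * v + ?W * F))"
      using P0 L0 Q0 by (intro affine_mat_mult) simp_all
    also have "P * L * (X powi n * Q) = P * X powi n * (L * Q)"
      by (simp only: ac_simps)
    also have "Z * v + P * (?W * B) + P * L * (S * v + ?W * F) =
        (Z + P * L * S) * v + ?W * (P * B + P * L * F)"
      by (simp only: distrib_left distrib_right ac_simps)
    finally show "eqn_value ?H ?f (t # u) (affine_mat (2 * q) X v) =
      affine_mat (2 * q) (P * X powi n * (L * Q)) ((Z + P * L * S) * v + ?W * (P * B + P * L * F))" .
  next
    \<comment> \<open>Telescoping: \<open>P - 1\<close> is a multiple of \<open>X - 1\<close>, while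
      \<open>L - 1\<close>, from the linear part of the coefficient, is a multiple of
      \<open>t^q\<close>.\<close>
    have "(X - 1) * (Z + P * L * S) + ?Y * (P * A + P * L * U) =
        (X - 1) * Z + P * L * ((X - 1) * S + ?Y * U) + P * (A * ?Y)"
      by (simp only: distrib_left ac_simps)
    also have "\<dots> = P - 1 + P * L * (X powi n * Q - 1) + P * (L - 1)"
      unfolding S Z(1) P_def L_def by simp
    also have "\<dots> = P * X powi n * (L * Q) - 1"
      by (simp add: right_diff_distrib ac_simps)
    finally show "(X - 1) * (Z + P * L * S) + ?Y * (P * A + P * L * U) = P * X powi n * (L * Q) - 1" .
  next
    show "(P * A + P * L * U) $ 0 = a g + \<alpha>"
      by (simp add: P0 L0 U A_def)
  next
    show "L * Q = 1 + fps_const (a g + \<alpha>) * ?Y + fps_X ^ (2 * q) * (A * fps_const \<alpha> + R + A * ?Y * R)"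
      unfolding L_def Q A_def[symmetric] fps_const_add[symmetric] mult_2 power_add
      by (simp only: distrib_left distrib_right mult_1_left mult_1_right ac_simps)
  qed
qed

text \<open>The Frobenius map enters only through the hypothesis that \<open>(1 + k t)^q\<close> has
  no middle terms; the condition on \<open>k'\<close> makes the coefficient of \<open>t^q\<close> in
  the linear part vanish.\<close>

lemma affine_embedding_solvable:
  fixes u :: "'a::{field,finite} mat eqn"
  assumes q: "q > 0" and "eqn_exponent u = r * int q"
    and k: "(1 + fps_const k * fps_X) ^ q = 1 + fps_const k' * fps_X ^ q"
    and k': "of_int r * k' = - (\<Sum>t\<leftarrow>u. a (snd t))"
    and nz: "(\<Sum>t\<leftarrow>u. a (snd t)) \<noteq> 0"
  shows "solvable_in (UT (2 * q + 1)) (affine_embedding q a b c) u"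
proof -
  define \<alpha> where "\<alpha> = (\<Sum>t\<leftarrow>u. a (snd t))"
  define X where "X = 1 + fps_const k * fps_X"
  let ?Y = "fps_X ^ q :: 'a fps" and ?W = "fps_X ^ (q - 1) :: 'a fps"
  have X0: "X $ 0 = 1" by (simp add: X_def)
  obtain S F U Q R where
    val: "\<And>v. eqn_value (UT (2 * q + 1)) (affine_embedding q a b c) u (affine_mat (2 * q) X v) =
          affine_mat (2 * q) (X powi eqn_exponent u * Q) (S * v + ?W * F)"
    and S: "(X - 1) * S + ?Y * U = X powi eqn_exponent u * Q - 1" and U: "U $ 0 = \<alpha>"
    and Q: "Q = 1 + fps_const \<alpha> * ?Y + fps_X ^ (2 * q) * R"
    using affine_embedding_eqn_value[OF X0 q] unfolding \<alpha>_def by blast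
  obtain R' where R': "(1 + fps_const k' * ?Y) powi r = 1 + fps_const (of_int r * k') * ?Y + ?Y ^ 2 * R'"
    using one_plus_powi[of ?Y k' r] q by auto
  have YY: "fps_X ^ (2 * q) = ?Y * ?Y" by (simp only: mult_2 power_add)
  have "X powi eqn_exponent u = (X ^ q) powi r"
    unfolding assms(2) mult.commute[of r] using X0 by (intro fps_powi_mult) simp
  also have "X ^ q = 1 + fps_const k' * ?Y" unfolding X_def by (rule k)
  finally have powi: "X powi eqn_exponent u = 1 - fps_const \<alpha> * ?Y + ?Y * ?Y * R'"
    unfolding R' k' \<alpha>_def[symmetric] power2_eq_square fps_const_neg[symmetric] by simp
  \<comment> \<open>The terms \<open>x * y\<close> cancel, so what is left besides 1 is a multiple
    of \<open>y * y\<close>, that is, of \<open>t^(2q)\<close>.\<close>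
  have "(1 - x * y + y * y * R') * (1 + x * y + y * y * R) =
      1 + y * y * (R + R' - x * x - x * y * R + x * y * R' + y * y * R * R')" for x y
    by (simp add: algebra_simps)
  from this[of "fps_const \<alpha>" ?Y] obtain D where
    D: "X powi eqn_exponent u * Q = 1 + fps_X ^ (2 * q) * D"
    unfolding powi Q YY by blast
  have "\<alpha> \<noteq> 0" using nz by (simp add: \<alpha>_def)
  then have "k' \<noteq> 0" using k' by (auto simp: \<alpha>_def)
  \<comment> \<open>\<open>k\<close> must be invertible because \<open>X - 1 = k t\<close> will be
    divided out; if it were zero, comparing coefficients at \<open>t^q\<close> would give
    \<open>k' = 0\<close>.\<close>
  have "k \<noteq> 0"
  proof
    assume "k = 0"
    then have "1 = (1 + fps_const k' * ?Y :: 'a fps)" using k by simp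
    then have "1 $ q = (1 + fps_const k' * ?Y :: 'a fps) $ q" by (rule arg_cong)
    then show False using q \<open>k' \<noteq> 0\<close> by simp
  qed
  \<comment> \<open>One factor \<open>t\<close> of \<open>t^q\<close> cancels against
    \<open>X - 1 = k t\<close>, leaving \<open>t^(q-1)\<close>: the same power that the embedding
    puts into every translation part.\<close>
  have Y: "?Y = fps_X * ?W" using q by (simp add: power_Suc[symmetric])
  define E where "E = fps_const (inverse k) * (?Y * D - U)"
  have "fps_X * (fps_const k * S) = fps_X * (?W * (?Y * D - U))"
  proof -
    have "fps_X * (fps_const k * S) = (X - 1) * S" by (simp add: X_def ac_simps)
    also have "\<dots> = fps_X ^ (2 * q) * D - ?Y * U"
      using S unfolding D by (simp add: eq_diff_eq)
    also have "\<dots> = ?Y * (?Y * D - U)" unfolding YY by (simp only: right_diff_distrib mult.assoc)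
    finally show ?thesis by (simp only: Y mult.assoc)
  qed
  then have "fps_const k * S = ?W * (?Y * D - U)" by simp
  then have "fps_const (inverse k) * (fps_const k * S) = ?W * E"
    unfolding E_def by (simp only: ac_simps)
  then have SE: "S = ?W * E"
    using \<open>k \<noteq> 0\<close> by (simp add: mult.assoc[symmetric])
  \<comment> \<open>The constant term is \<open>- \<alpha> / k\<close>, as \<open>t^q * D\<close>
    contributes none; so \<open>E\<close> is a unit and \<open>S v = - t^(q-1) F\<close> can be
    solved.\<close>
  have E0: "E $ 0 \<noteq> 0" using q U \<open>\<alpha> \<noteq> 0\<close> \<open>k \<noteq> 0\<close> by (simp add: E_def)
  define v where "v = - inverse E * F"
  have "S * v + ?W * F = ?W * (F - (inverse E * E) * F)"
    unfolding SE v_def by (simp add: right_diff_distrib ac_simps)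
  also have "\<dots> = 0" using inverse_mult_eq_1[OF E0] by simp
  finally have "eqn_value (UT (2 * q + 1)) (affine_embedding q a b c) u (affine_mat (2 * q) X v) =
      affine_mat (2 * q) (1 + fps_X ^ (2 * q) * D) (0 + fps_X ^ (2 * q) * 0)"
    unfolding val D by simp
  also have "\<dots> = affine_mat (2 * q) 1 0"
    using q by (intro affine_mat_mod_X_power) simp
  also have "\<dots> = \<one>\<^bsub>UT (2 * q + 1)\<^esub>" by (simp add: affine_mat_1_0)
  finally show ?thesis
    unfolding solvable_in_def using affine_mat_carrier[OF X0, of "2 * q"] by auto
qed

section \<open>Commuting solutions and the central embedding: both sums are zero\<close>

lemma (in group) int_pow_commutes:
  fixes e :: int
  assumes "x \<otimes> y = y \<otimes> x" and x: "x \<in> carrier G" and y: "y \<in> carrier G"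
  shows "x [^] e \<otimes> y = y \<otimes> x [^] e"
proof (cases e rule: int_cases2)
  case (nonneg n)
  then show ?thesis using group_commutes_pow[OF assms] by (simp only: int_pow_int)
next
  case (nonpos n)
  have "inv (x [^] n) \<otimes> y = inv (x [^] n) \<otimes> (y \<otimes> x [^] n) \<otimes> inv (x [^] n)"
    using x y by (simp add: m_assoc)
  also have "\<dots> = y \<otimes> inv (x [^] n)"
    using x y by (simp add: group_commutes_pow[OF assms, symmetric] m_assoc[symmetric])
  finally show ?thesis by (simp only: nonpos int_pow_neg_int[OF x])
qed

text \<open>All powers of \<open>h\<close> can be moved to the front; the value at the identity is
  the product of the coefficients. Membership in the carrier is included because the induction step
  needs it for associativity.\<close>

lemma (in group) eqn_value_commuting:
  assumes h: "h \<in> carrier G" and u: "\<And>t. t \<in> set u \<Longrightarrow> \<phi> (snd t) \<in> carrier G"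
    and comm: "\<And>t. t \<in> set u \<Longrightarrow> h \<otimes> \<phi> (snd t) = \<phi> (snd t) \<otimes> h"
  shows "eqn_value G \<phi> u h = h [^] eqn_exponent u \<otimes> eqn_value G \<phi> u \<one> \<and>
    eqn_value G \<phi> u \<one> \<in> carrier G"
  using u comm
proof (induction u)
  case Nil
  then show ?case by (simp add: eqn_exponent_def)
next
  case (Cons t u)
  let ?g = "\<phi> (snd t)" and ?n = "eqn_exponent u" and ?T = "eqn_value G \<phi> u \<one>"
  have g: "?g \<in> carrier G" and hg: "h \<otimes> ?g = ?g \<otimes> h" by (auto intro: Cons.prems)
  have IH: "eqn_value G \<phi> u h = h [^] ?n \<otimes> ?T" "?T \<in> carrier G"
    using Cons.IH Cons.prems by auto
  have "eqn_value G \<phi> (t # u) h = h [^] fst t \<otimes> (?g \<otimes> h [^] ?n) \<otimes> ?T"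
    using IH g h by (simp add: m_assoc)
  also have "\<dots> = h [^] fst t \<otimes> h [^] ?n \<otimes> (?g \<otimes> ?T)"
    unfolding int_pow_commutes[OF hg h g, symmetric] using IH g h by (simp add: m_assoc)
  also have "h [^] fst t \<otimes> h [^] ?n = h [^] eqn_exponent (t # u)"
    using h by (simp add: int_pow_mult eqn_exponent_def)
  finally show ?case using IH g by simp
qed

text \<open>For \<open>n = q + 2\<close>, the module \<open>F[[t]]/(t^(q+1))\<close> with basis \<open>t^q, \<dots>, t, 1\<close>
  together with one further basis vector \<open>e\<close> in front of \<open>1\<close>; larger \<open>n\<close> adds an identity block.
  The matrix acts on the module as
  \<open>Y\<close>, except that it maps \<open>1\<close> to \<open>Y + b e\<close>, and it maps \<open>e\<close> to \<open>e + a t^q\<close>.\<close>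

definition central_mat :: "nat \<Rightarrow> nat \<Rightarrow> 'a::field fps \<Rightarrow> 'a \<Rightarrow> 'a \<Rightarrow> 'a mat" where
  "central_mat n q Y a b = mat n n (\<lambda>(i, j).
     if i = j then 1
     else if j < i then 0
     else if j < q then Y $ (j - i)
     else if j = q then if i = 0 then a else 0
     else if j = Suc q then if i < q then Y $ (q - i) else b
     else 0)"

lemma central_mat_carrier: "central_mat n q Y a b \<in> carrier (UT n)"
  by (simp add: carrier_UT_iff central_mat_def)

lemma central_mat_cong:
  assumes "\<And>i. i \<le> q \<Longrightarrow> Y $ i = Z $ i"
  shows "central_mat n q Y a b = central_mat n q Z a b"
  unfolding central_mat_def using assms by (intro cong_mat) simp_all

text \<open>The vector \<open>e\<close> adds just one path, from \<open>1\<close> through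
  \<open>e\<close> to \<open>t^q\<close>; it contributes \<open>a * b'\<close> in degree
  \<open>q\<close>, and the rest multiplies like power series.\<close>

lemma central_mat_mult:
  fixes Y Z :: "'a::field fps"
  assumes Y: "Y $ 0 = 1" and Z: "Z $ 0 = 1" and q: "q > 0"
  shows "central_mat n q Y a b * central_mat n q Z a' b' =
    central_mat n q (Y * Z + fps_const (a * b') * fps_X ^ q) (a + a') (b + b')"
    (is "?A * ?B = ?C")
proof (rule eq_matI)
  have A: "?A \<in> carrier (UT n)" and B: "?B \<in> carrier (UT n)"
    by (rule central_mat_carrier)+
  fix i j assume "i < dim_row ?C" "j < dim_col ?C"
  then have ij: "i < n" "j < n" by (simp_all add: central_mat_def)
  have diag: "?A $$ (l, l) = 1" "?B $$ (l, l) = 1" if "l < n" for l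
    using that by (simp_all add: central_mat_def)
  have "(?A * ?B) $$ (i, j) = (\<Sum>l\<in>{i..j}. ?A $$ (i, l) * ?B $$ (l, j))"
    by (rule UT_mult_index[OF A B ij])
  also have "\<dots> = ?C $$ (i, j)"
  proof -
    consider "j < i" | "i = j" | "i < j" "j < q" | "i < q" "j = q"
      | "i < q" "j = Suc q" | "i = q" "j = Suc q" | "i < j" "Suc q < j"
      by linarith
    then show ?thesis
    proof cases
      case 1
      then show ?thesis using ij by (simp add: central_mat_def)
    next
      case 2
      then show ?thesis using ij by (simp add: central_mat_def)
    next
      case 3
      then have "(\<Sum>l\<in>{i..j}. ?A $$ (i, l) * ?B $$ (l, j)) = (\<Sum>l\<in>{i..j}. Y $ (l - i) * Z $ (j - l))"
        using ij by (intro sum.cong) (auto simp: central_mat_def Y Z)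
      then show ?thesis using 3 ij by (simp add: sum_fps_nth_shift central_mat_def)
    next
      case 4
      \<comment> \<open>In the column of \<open>e\<close> only the two summands with a diagonal
        factor survive: strictly between \<open>i\<close> and \<open>q\<close> the right factor is
        zero.\<close>
      have "(\<Sum>l\<in>{i..q}. ?A $$ (i, l) * ?B $$ (l, q)) =
          (\<Sum>l\<in>{i..q}. (if l = q then ?A $$ (i, q) else 0) + (if l = i then ?B $$ (i, q) else 0))"
        using 4 ij q by (intro sum.cong) (auto simp: central_mat_def)
      also have "\<dots> = ?A $$ (i, q) + ?B $$ (i, q)"
        using 4 by (simp add: sum.distrib)
      finally show ?thesis using 4 ij by (simp add: central_mat_def)
    next
      case 5
      have "{i..Suc q} = insert (Suc q) {i..q}" using 5 by auto
      then have "(\<Sum>l\<in>{i..j}. ?A $$ (i, l) * ?B $$ (l, j)) =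
          ?A $$ (i, Suc q) * ?B $$ (Suc q, Suc q) + (\<Sum>l\<in>{i..q}. ?A $$ (i, l) * ?B $$ (l, Suc q))"
        using 5 by simp
      also have "?A $$ (i, Suc q) * ?B $$ (Suc q, Suc q) = Y $ (q - i)"
        using 5 ij by (simp add: central_mat_def)
      \<comment> \<open>The basis vector \<open>1\<close> has index \<open>q + 1\<close> instead of
        \<open>q\<close>. So at \<open>l = q\<close> the path through \<open>e\<close> replaces the
        last term of the convolution, and the summand split off at \<open>Suc q\<close> restores
        that term.\<close>
      also have "(\<Sum>l\<in>{i..q}. ?A $$ (i, l) * ?B $$ (l, Suc q)) =
          (\<Sum>l\<in>{i..q}. Y $ (l - i) * Z $ (q - l)
             + (if l = q then (if i = 0 then a * b' else 0) - Y $ (q - i) else 0))"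
        using 5 ij by (intro sum.cong) (auto simp: central_mat_def Y Z)
      also have "\<dots> = (Y * Z) $ (q - i) + ((if i = 0 then a * b' else 0) - Y $ (q - i))"
        using 5 by (simp add: sum.distrib sum_fps_nth_shift)
      finally have "(\<Sum>l\<in>{i..j}. ?A $$ (i, l) * ?B $$ (l, j)) =
          (Y * Z) $ (q - i) + (if i = 0 then a * b' else 0)"
        by simp
      moreover have "q - i = q \<longleftrightarrow> i = 0" using 5 by auto
      ultimately show ?thesis
        using 5 ij by (simp add: central_mat_def)
    next
      case 6
      then have "{i..j} = {q, Suc q}" by auto
      then show ?thesis using 6 ij by (simp add: central_mat_def)
    next
      case 7
      have "(\<Sum>l\<in>{i..j}. ?A $$ (i, l) * ?B $$ (l, j)) = 0"
        using 7 ij by (intro sum.neutral) (auto simp: central_mat_def)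
      then show ?thesis using 7 ij by (simp add: central_mat_def)
    qed
  qed
  finally show "(?A * ?B) $$ (i, j) = ?C $$ (i, j)" .
qed (simp_all add: central_mat_def)

lemma central_mat_1: "central_mat n q 1 0 0 = 1\<^sub>m n"
  by (intro eq_matI) (auto simp: central_mat_def)

text \<open>Central elements, with \<open>a = b = 0\<close>, fix \<open>e\<close> and act on the
  power series as multiplication by \<open>1 + c t^q\<close>. Their roots are sought among the
  multiplications by \<open>1 + k t\<close>.\<close>

definition central_embedding ::
    "nat \<Rightarrow> nat \<Rightarrow> ('a::field mat \<Rightarrow> 'a) \<Rightarrow> ('a mat \<Rightarrow> 'a) \<Rightarrow> ('a mat \<Rightarrow> 'a) \<Rightarrow> 'a mat \<Rightarrow> 'a mat" where
  "central_embedding n q a b c A = central_mat n q (1 + fps_const (c A) * fps_X ^ q) (a A) (b A)"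

lemma central_mat_mult_X_power:
  fixes x y a b a' b' :: "'a::field"
  assumes q: "q > 0"
  shows "central_mat n q (1 + fps_const x * fps_X ^ q) a b *
      central_mat n q (1 + fps_const y * fps_X ^ q) a' b' =
    central_mat n q (1 + fps_const (x + y + a * b') * fps_X ^ q) (a + a') (b + b')"
proof -
  let ?Y = "fps_X ^ q :: 'a fps"
  have "(1 + f * Y) * (1 + g * Y) + h * Y = (1 + (f + g + h) * Y) + Y * (Y * f * g)"
    for f g h Y :: "'a fps"
    by (simp add: algebra_simps)
  note expand = this[of "fps_const x" ?Y "fps_const y" "fps_const (a * b')", unfolded fps_const_add]
  have Y0: "?Y $ 0 = 0" using q by simp
  \<comment> \<open>Only the degrees up to \<open>q\<close> are visible, and the product term is
    divisible by \<open>t^(2q)\<close>.\<close>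
  have nth: "(f + ?Y * (?Y * fps_const x * fps_const y)) $ i = f $ i" if "i \<le> q" for f i
  proof (cases "i = q")
    case True
    then show ?thesis using Y0 by (simp add: fps_X_power_mult_nth)
  next
    case False
    then show ?thesis using that by (simp add: fps_X_power_mult_nth mult.assoc)
  qed
  have "central_mat n q (1 + fps_const x * ?Y) a b * central_mat n q (1 + fps_const y * ?Y) a' b' =
      central_mat n q ((1 + fps_const x * ?Y) * (1 + fps_const y * ?Y) + fps_const (a * b') * ?Y)
        (a + a') (b + b')"
    using Y0 by (intro central_mat_mult q) simp_all
  also have "\<dots> = central_mat n q (1 + fps_const (x + y + a * b') * ?Y) (a + a') (b + b')"
    unfolding expand by (intro central_mat_cong nth)
  finally show ?thesis .
qed

lemma central_embedding_mon:
  assumes coords: "heisenberg_coords a b c" and q: "q > 0" and n: "Suc q < n"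
  shows "central_embedding n q a b c \<in> mon (UT 3) (UT n)"
proof -
  let ?f = "central_embedding n q a b c"
  have "?f A \<in> carrier (UT n)" for A
    unfolding central_embedding_def by (rule central_mat_carrier)
  moreover have "?f (A * B) = ?f A * ?f B" if "A \<in> carrier (UT 3)" "B \<in> carrier (UT 3)" for A B
    unfolding central_embedding_def central_mat_mult_X_power[OF q] heisenberg_coordsD(1-3)[OF coords that] ..
  moreover have "inj_on ?f (carrier (UT 3))"
  proof (rule inj_onI)
    fix A B assume A: "A \<in> carrier (UT 3)" and B: "B \<in> carrier (UT 3)" and eq: "?f A = ?f B"
    have "?f A $$ (0, q) = a A" "?f A $$ (q, Suc q) = b A" "?f A $$ (0, Suc q) = c A" for A
      using q n by (simp_all add: central_embedding_def central_mat_def)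
    with eq have "a A = a B" "b A = b B" "c A = c B" by metis+
    then show "A = B" by (rule heisenberg_coordsD(4)[OF coords A B])
  qed
  ultimately show ?thesis
    unfolding mon_def hom_def mult_UT by (intro CollectI conjI ballI funcsetI)
qed

text \<open>This is the product of the coefficients. Its third coordinate \<gamma> may be anything,
  since every central element can be cancelled later.\<close>

lemma central_embedding_eqn_value_1:
  fixes u :: "'a::{field,finite} mat eqn"
  assumes q: "q > 0"
  shows "\<exists>\<gamma>. eqn_value (UT n) (central_embedding n q a b c) u (1\<^sub>m n) =
    central_mat n q (1 + fps_const \<gamma> * fps_X ^ q) (\<Sum>t\<leftarrow>u. a (snd t)) (\<Sum>t\<leftarrow>u. b (snd t))"
proof (induction u)
  case Nil
  show ?case by (intro exI[of _ 0]) (simp add: central_mat_1)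
next
  case (Cons t u)
  interpret group "UT n :: 'a mat monoid" by (rule group_UT)
  let ?f = "central_embedding n q a b c"
  obtain \<gamma> where \<gamma>: "eqn_value (UT n) ?f u (1\<^sub>m n) =
    central_mat n q (1 + fps_const \<gamma> * fps_X ^ q) (\<Sum>t\<leftarrow>u. a (snd t)) (\<Sum>t\<leftarrow>u. b (snd t))"
    using Cons.IH by blast
  have f: "?f (snd t) \<in> carrier (UT n)"
    unfolding central_embedding_def by (rule central_mat_carrier)
  have "eqn_value (UT n) ?f (t # u) (1\<^sub>m n) = ?f (snd t) * eqn_value (UT n) ?f u (1\<^sub>m n)"
    using f int_pow_one l_one[OF f] by simp
  then show ?case
    unfolding \<gamma> central_embedding_def central_mat_mult_X_power[OF q] by auto
qed

lemma central_mat_int_pow: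
  fixes y :: "'a::{field,finite}" and e :: int
  assumes q: "q > 0"
  shows "central_mat n q (1 + fps_const y * fps_X ^ q) 0 0 [^]\<^bsub>UT n\<^esub> e =
    central_mat n q (1 + fps_const (of_int e * y) * fps_X ^ q) 0 0"
proof -
  interpret group "UT n :: 'a mat monoid" by (rule group_UT)
  let ?z = "\<lambda>y. central_mat n q (1 + fps_const y * fps_X ^ q) 0 0 :: 'a mat"
  have add: "?z x * ?z y = ?z (x + y)" for x y
    by (simp only: central_mat_mult_X_power[OF q] add_0_right mult_zero_right)
  have z0: "?z 0 = 1\<^sub>m n" by (simp add: central_mat_1)
  have nat: "?z y [^]\<^bsub>UT n\<^esub> m = ?z (of_nat m * y)" for m :: nat
  proof (induction m)
    case 0
    show ?case by (simp add: central_mat_1)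
  next
    case (Suc m)
    have "?z y [^]\<^bsub>UT n\<^esub> Suc m = ?z (of_nat m * y) * ?z y"
      by (simp only: nat_pow_Suc Suc mult_UT)
    also have "\<dots> = ?z (of_nat (Suc m) * y)"
      unfolding add by (simp only: of_nat_Suc distrib_right mult_1_left add.commute)
    finally show ?case .
  qed
  show ?thesis
  proof (cases e rule: int_cases2)
    case (nonneg m)
    show ?thesis unfolding nonneg int_pow_int nat of_int_of_nat_eq ..
  next
    case (nonpos m)
    have "?z (of_int e * y) \<otimes>\<^bsub>UT n\<^esub> ?z (of_nat m * y) = \<one>\<^bsub>UT n\<^esub>"
      unfolding nonpos mult_UT one_UT add z0[symmetric] by simp
    then have "inv\<^bsub>UT n\<^esub> (?z y [^]\<^bsub>UT n\<^esub> m) = ?z (of_int e * y)"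
      unfolding nat by (rule inv_equality) (rule central_mat_carrier)+
    then show ?thesis
      unfolding nonpos int_pow_neg_int[OF central_mat_carrier] .
  qed
qed

lemma central_embedding_solvable:
  fixes u :: "'a::{field,finite} mat eqn"
  assumes q: "q > 0" and n: "Suc q < n" and exponent: "eqn_exponent u = r * int q"
    and frobenius: "\<And>y :: 'a. \<exists>k. (1 + fps_const k * fps_X) ^ q = 1 + fps_const y * fps_X ^ q"
    and r: "of_int r \<noteq> (0 :: 'a)"
    and zero: "(\<Sum>t\<leftarrow>u. a (snd t)) = 0" "(\<Sum>t\<leftarrow>u. b (snd t)) = 0"
  shows "solvable_in (UT n) (central_embedding n q a b c) u"
proof -
  interpret group "UT n :: 'a mat monoid" by (rule group_UT)
  let ?f = "central_embedding n q a b c"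
  obtain \<gamma> where \<gamma>: "eqn_value (UT n) ?f u (1\<^sub>m n) = central_mat n q (1 + fps_const \<gamma> * fps_X ^ q) 0 0"
    using central_embedding_eqn_value_1[OF q, of n a b c u] unfolding zero by blast
  \<comment> \<open>If \<open>h^q\<close> is the central element with parameter \<open>y\<close>,
    then the power with exponent \<open>r * q\<close> has parameter \<open>r y\<close>, which must
    cancel \<gamma>.\<close>
  define y where "y = - \<gamma> / of_int r"
  obtain k where k: "(1 + fps_const k * fps_X) ^ q = 1 + fps_const y * fps_X ^ q"
    using frobenius by blast
  define X where "X = 1 + fps_const k * fps_X"
  define h where "h = central_mat n q X 0 0"
  have X0: "X $ 0 = 1" by (simp add: X_def)
  have h: "h \<in> carrier (UT n)" unfolding h_def by (rule central_mat_carrier)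
  have hpow: "h [^]\<^bsub>UT n\<^esub> m = central_mat n q (X ^ m) 0 0" for m :: nat
  proof (induction m)
    case 0
    show ?case by (simp add: central_mat_1)
  next
    case (Suc m)
    have "h [^]\<^bsub>UT n\<^esub> Suc m = central_mat n q (X ^ m) 0 0 * central_mat n q X 0 0"
      unfolding nat_pow_Suc Suc mult_UT unfolding h_def ..
    also have "\<dots> = central_mat n q (X ^ Suc m) 0 0"
      using X0 by (subst central_mat_mult[OF _ X0 q]) (simp_all add: fps_nth_power_0 mult.commute)
    finally show ?case .
  qed
  have "h [^]\<^bsub>UT n\<^esub> eqn_exponent u = (h [^]\<^bsub>UT n\<^esub> int q) [^]\<^bsub>UT n\<^esub> r"
    unfolding exponent int_pow_pow[OF h] by (simp only: mult.commute)
  also have "h [^]\<^bsub>UT n\<^esub> int q = central_mat n q (1 + fps_const y * fps_X ^ q) 0 0"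
    unfolding int_pow_int hpow unfolding X_def k ..
  also have "\<dots> [^]\<^bsub>UT n\<^esub> r = central_mat n q (1 + fps_const (- \<gamma>) * fps_X ^ q) 0 0"
    unfolding central_mat_int_pow[OF q] using r by (simp add: y_def)
  finally have hexp: "h [^]\<^bsub>UT n\<^esub> eqn_exponent u = central_mat n q (1 + fps_const (- \<gamma>) * fps_X ^ q) 0 0" .
  have f: "?f A \<in> carrier (UT n)" for A
    unfolding central_embedding_def by (rule central_mat_carrier)
  \<comment> \<open>\<open>h\<close> has \<open>a = b = 0\<close>, so neither order of the product
    has a cross term, and the series commute.\<close>
  have comm: "h \<otimes>\<^bsub>UT n\<^esub> ?f A = ?f A \<otimes>\<^bsub>UT n\<^esub> h" for A
  proof -
    have L0: "(1 + fps_const (c A) * fps_X ^ q) $ 0 = 1" using q by simp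
    show ?thesis
      unfolding mult_UT h_def central_embedding_def central_mat_mult[OF X0 L0 q] central_mat_mult[OF L0 X0 q]
      by (simp add: mult.commute)
  qed
  have "eqn_value (UT n) ?f u h = h [^]\<^bsub>UT n\<^esub> eqn_exponent u \<otimes>\<^bsub>UT n\<^esub> eqn_value (UT n) ?f u \<one>\<^bsub>UT n\<^esub>"
    by (rule eqn_value_commuting[where \<phi> = ?f, OF h f comm, THEN conjunct1])
  also have "\<dots> = \<one>\<^bsub>UT n\<^esub>"
    unfolding one_UT \<gamma> hexp mult_UT central_mat_mult_X_power[OF q] by (simp add: central_mat_1)
  finally show ?thesis unfolding solvable_in_def using h by blast
qed

section \<open>Frobenius roots\<close>

lemma CHAR_fps: "CHAR('a::comm_ring_1 fps) = CHAR('a)"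
proof (rule CHAR_eqI)
  show "of_nat CHAR('a) = (0 :: 'a fps)"
    by (simp add: fps_of_nat[symmetric])
  fix n assume "of_nat n = (0 :: 'a fps)"
  then have "fps_const (of_nat n :: 'a) = 0" by (simp add: fps_of_nat)
  then show "CHAR('a) dvd n" by (simp add: of_nat_eq_0_iff_char_dvd)
qed

text \<open>The \<open>q\<close>-th power map is additive, so it is injective because its kernel is
  trivial, and thus surjective on a finite field.\<close>

lemma frobenius_power_surj:
  fixes x :: "'a::{field,finite}"
  assumes "prime CHAR('a)" and "q = CHAR('a) ^ s"
  shows "\<exists>y. y ^ q = x"
proof -
  have "q > 0" using assms prime_gt_0_nat by simp
  have "inj (\<lambda>y :: 'a. y ^ q)"
  proof (rule injI)
    fix y z :: 'a assume eq: "y ^ q = z ^ q"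
    have "y ^ q = z ^ q + (y - z) ^ q"
      using freshmans_dream'[OF assms, of z "y - z"] by simp
    then have "(y - z) ^ q = 0" using eq by simp
    then show "y = z" by simp
  qed
  then have "surj (\<lambda>y :: 'a. y ^ q)" by (simp add: finite_UNIV_inj_surj)
  then show ?thesis by (metis surjD)
qed

text \<open>If \<open>k\<close> is a \<open>q\<close>-th root of \<open>x\<close>, the freshman's
  dream in the power series ring makes \<open>1 + k t\<close> a \<open>q\<close>-th root of
  \<open>1 + x t^q\<close>.\<close>

lemma fps_frobenius:
  fixes x :: "'a::{field,finite}"
  assumes "prime CHAR('a)" and "q = CHAR('a) ^ s"
  shows "\<exists>k. (1 + fps_const k * fps_X) ^ q = 1 + fps_const x * fps_X ^ q"
proof -
  obtain k where k: "k ^ q = x" using frobenius_power_surj[OF assms] by blast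
  have "(1 + fps_const k * fps_X) ^ q = 1 ^ q + (fps_const k * fps_X) ^ q"
    using assms by (intro freshmans_dream'[of _ s]) (simp_all add: CHAR_fps)
  also have "\<dots> = 1 + fps_const x * fps_X ^ q"
    by (simp add: power_mult_distrib fps_const_power k)
  finally show ?thesis by blast
qed

section \<open>Case distinction on the two sums\<close>

theorem theorem3p7:
  fixes p s :: nat and r :: int and u :: "('a::{field,finite}) mat eqn"
  assumes "prime p"
    and "CARD('a) = p"
    and "eqn_over (UT 3) u"
    and "regular_eqn u"
    and "eqn_exponent u = r * int p ^ s"
    and "gcd r (int p) = 1"
  shows "\<exists>(H :: 'a mat monoid) \<phi>.
           overgroup (UT 3 :: 'a mat monoid) H \<phi> \<and>
           H \<cong> (UT (2 * p ^ s + 1) :: 'a mat monoid) \<and>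
           solvable_in H \<phi> u"
proof -
  define q where "q = p ^ s"
  define H where "H = (UT (2 * q + 1) :: 'a mat monoid)"
  have q: "q > 0" using assms(1) by (simp add: q_def prime_gt_0_nat)
  have "CHAR('a) dvd p" using CHAR_dvd_CARD[where ?'a = 'a] assms(2) by simp
  moreover have "CHAR('a) \<noteq> 1" by simp
  ultimately have char: "CHAR('a) = p"
    using assms(1) prime_nat_iff by blast
  \<comment> \<open>If \<open>r\<close> vanished in the field, the characteristic \<open>p\<close>
    would divide \<open>r\<close> and hence the gcd.\<close>
  have r: "of_int r \<noteq> (0 :: 'a)"
  proof
    assume "of_int r = (0 :: 'a)"
    then have "int p dvd gcd r (int p)" by (simp add: of_int_eq_0_iff_char_dvd char)
    then show False using assms(1,6) by simp
  qed
  have frobenius: "\<exists>k. (1 + fps_const k * fps_X) ^ q = 1 + fps_const y * fps_X ^ q" for y :: 'a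
    using assms(1) by (intro fps_frobenius[of _ s]) (simp_all add: char q_def)
  have exponent: "eqn_exponent u = r * int q" using assms(5) by (simp add: q_def)
  \<comment> \<open>Stated for arbitrary coordinates, so that it covers \<alpha> and, after the
    swap, \<beta>.\<close>
  have affine: "\<exists>\<phi>. \<phi> \<in> mon (UT 3) H \<and> solvable_in H \<phi> u"
    if coords: "heisenberg_coords a b c" and nz: "(\<Sum>t\<leftarrow>u. a (snd t)) \<noteq> 0" for a b c :: "'a mat \<Rightarrow> 'a"
  proof -
    define y where "y = - (\<Sum>t\<leftarrow>u. a (snd t)) / of_int r"
    obtain k where k: "(1 + fps_const k * fps_X) ^ q = 1 + fps_const y * fps_X ^ q"
      using frobenius by blast
    have "of_int r * y = - (\<Sum>t\<leftarrow>u. a (snd t))" using r by (simp add: y_def)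
    then show ?thesis
      unfolding H_def
      using affine_embedding_mon[OF coords q] affine_embedding_solvable[OF q exponent k _ nz]
      by blast
  qed
  let ?a = "\<lambda>A :: 'a mat. A $$ (0, 1)" and ?b = "\<lambda>A :: 'a mat. A $$ (1, 2)"
    and ?c = "\<lambda>A :: 'a mat. A $$ (0, 2)"
  note coords = heisenberg_coords_entries[where ?'a = 'a]
  have "\<exists>\<phi>. \<phi> \<in> mon (UT 3) H \<and> solvable_in H \<phi> u"
  proof -
    consider "(\<Sum>t\<leftarrow>u. ?a (snd t)) \<noteq> 0" | "(\<Sum>t\<leftarrow>u. ?b (snd t)) \<noteq> 0"
      | "(\<Sum>t\<leftarrow>u. ?a (snd t)) = 0" "(\<Sum>t\<leftarrow>u. ?b (snd t)) = 0"
      by blast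
    then show ?thesis
    proof cases
      case 1
      then show ?thesis by (rule affine[OF coords])
    next
      case 2
      then show ?thesis by (rule affine[OF heisenberg_coords_swap[OF coords]])
    next
      case 3
      \<comment> \<open>The central embedding takes \<open>q + 2\<close> dimensions, which fit into
        \<open>2 * q + 1\<close> because \<open>q\<close> is at least 1.\<close>
      have n: "Suc q < 2 * q + 1" using q by simp
      show ?thesis
        unfolding H_def
        using central_embedding_mon[OF coords q n]
          central_embedding_solvable[OF q n exponent frobenius r 3]
        by blast
    qed
  qed
  then obtain \<phi> where "\<phi> \<in> mon (UT 3) H" "solvable_in H \<phi> u" by blast
  moreover have "group H" unfolding H_def by (rule group_UT)
  moreover have "H \<cong> (UT (2 * p ^ s + 1) :: 'a mat monoid)"
    unfolding H_def q_def by (rule iso_refl)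
  ultimately show ?thesis unfolding overgroup_def by blast
qed

end
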